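(* Let $\mathcal{I}$ be an admissible ideal on $\mathbb{N}$ and let $X$ be a topological space (no separation axiom is assumed). Then $X$ has an $\mathcal{I}$-$csf$-network if and only if there exist a metric space $M$ and a continuous, surjective, $\mathcal{I}$-covering mapping $f:M\to X$.
   Context: $\mathbb{N}$ is the set of positive integers. An ideal $\mathcal{I}$ on $\mathbb{N}$ is a family of subsets of $\mathbb{N}$ closed under subsets and finite unions; it is admissible if $\mathbb{N}\notin\mathcal{I}$ and $\{n\}\in\mathcal{I}$ for every $n\in\mathbb{N}$. A sequence $\{x_n\}_{n\in\mathbb{N}}$ in a topological space $X$ is $\mathcal{I}$-convergent to $x\in X$ (written $x_n\xrightarrow{\mathcal{I}}x$) if $\{n\in\mathbb{N}:x_n\notin U\}\in\mathcal{I}$ for every neighborhood $U$ of $x$. A mapping $f:X\to Y$ is $\mathcal{I}$-covering if whenever $y_n\xrightarrow{\mathcal{I}}y$ in $Y$, there is a sequence $x_n\xrightarrow{\mathcal{I}}x$ in $X$ with $x\in f^{-1}(y)$ and $x_n\in f^{-1}(y_n)$ for every $n$. A family $\mathcal{P}$ of subsets of $X$ is an $\mathcal{I}$-$csf$-network at a point $x\in X$ if for every sequence $\{x_n\}_{n\in\mathbb{N}}$ in $X$ that is $\mathcal{I}$-convergent to $x$ there is a countable subfamily $\mathcal{P}'\subseteq\mathcal{P}$ such that for every open $U\ni x$ there are $I\in\mathcal{I}$ and $P\in\mathcal{P}'$ with $\{x\}\cup\{x_n:n\in\mathbb{N}\setminus I\}\subseteq P\subseteq U$. A family $\mathcal{P}$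 is an $\mathcal{I}$-$csf$-network for $X$ if $\mathcal{P}=\bigcup_{x\in X}\mathcal{P}_x$ where each $\mathcal{P}_x$ is an $\mathcal{I}$-$csf$-network at $x$. "$X$ has an $\mathcal{I}$-$csf$-network" means that there is an $\mathcal{I}$-$csf$-network for $X$. *)

theory Defs
  imports "HOL-Analysis.Analysis"
begin

text \<open>Sequences and ideals are indexed by the positive integers \<open>{1..}\<close>. A sequence is a function of type \<open>nat \<Rightarrow> 'a\<close> whose value at \<open>0\<close> is
  never looked at.\<close>

definition set_ideal :: "nat set set \<Rightarrow> bool" where
  "set_ideal \<I> \<longleftrightarrow>
     \<I> \<subseteq> Pow {1..} \<and> {} \<in> \<I> \<and>
     (\<forall>A B. A \<in> \<I> \<longrightarrow> B \<subseteq> A \<longrightarrow> B \<in> \<I>) \<and>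
     (\<forall>A B. A \<in> \<I> \<longrightarrow> B \<in> \<I> \<longrightarrow> A \<union> B \<in> \<I>)"

definition admissible_ideal :: "nat set set \<Rightarrow> bool" where
  "admissible_ideal \<I> \<longleftrightarrow> set_ideal \<I> \<and> {1..} \<notin> \<I> \<and> (\<forall>n\<ge>1. {n} \<in> \<I>)"

text \<open>Neighbourhoods need not be open: \<open>U\<close> is a neighbourhood of \<open>x\<close> iff
  \<open>x\<close> lies in the interior of \<open>U\<close>.\<close>

definition ideal_convergent ::
    "nat set set \<Rightarrow> 'a topology \<Rightarrow> (nat \<Rightarrow> 'a) \<Rightarrow> 'a \<Rightarrow> bool" where
  "ideal_convergent \<I> X s x \<longleftrightarrow>
     (\<forall>n\<ge>1. s n \<in> topspace X) \<and> x \<in> topspace X \<and>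
     (\<forall>U. U \<subseteq> topspace X \<longrightarrow> x \<in> X interior_of U \<longrightarrow> {n \<in> {1..}. s n \<notin> U} \<in> \<I>)"

definition ideal_covering_map ::
    "nat set set \<Rightarrow> 'a topology \<Rightarrow> 'b topology \<Rightarrow> ('a \<Rightarrow> 'b) \<Rightarrow> bool" where
  "ideal_covering_map \<I> X Y f \<longleftrightarrow>
     f \<in> topspace X \<rightarrow> topspace Y \<and>
     (\<forall>t y. ideal_convergent \<I> Y t y \<longrightarrow>
        (\<exists>s x. ideal_convergent \<I> X s x \<and> f x = y \<and> (\<forall>n\<ge>1. f (s n) = t n)))"

definition ideal_csf_network_at ::
    "nat set set \<Rightarrow> 'a topology \<Rightarrow> 'a \<Rightarrow> 'a set set \<Rightarrow> bool" where
  "ideal_csf_network_at \<I> X x \<P> \<longleftrightarrow>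
     \<P> \<subseteq> Pow (topspace X) \<and>
     (\<forall>s. ideal_convergent \<I> X s x \<longrightarrow>
        (\<exists>\<P>'. countable \<P>' \<and> \<P>' \<subseteq> \<P> \<and>
           (\<forall>U. openin X U \<longrightarrow> x \<in> U \<longrightarrow>
              (\<exists>A\<in>\<I>. \<exists>P\<in>\<P>'. {x} \<union> s ` ({1..} - A) \<subseteq> P \<and> P \<subseteq> U))))"

definition ideal_csf_network ::
    "nat set set \<Rightarrow> 'a topology \<Rightarrow> 'a set set \<Rightarrow> bool" where
  "ideal_csf_network \<I> X \<P> \<longleftrightarrow>
     (\<exists>\<P>\<^sub>x. \<P> = (\<Union>x\<in>topspace X. \<P>\<^sub>x x) \<and>
        (\<forall>x\<in>topspace X. ideal_csf_network_at \<I> X x (\<P>\<^sub>x x)))"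

text \<open>HOL cannot quantify existentially over types, so ``there is a metric space'' needs a
  type of points that is large enough for every space with points in \<open>'a\<close>. A disjoint sum,
  indexed by sequences in \<open>'a\<close> with their limits (stored at index \<open>0\<close>), of countable
  metric spaces suffices. This gives the following point type; the carrier of the metric
  space may be any subset of it. For the converse implication no such choice is needed: it
  can be stated for an arbitrary type of points.\<close>

type_synonym 'a seq_point = "(nat \<Rightarrow> 'a) \<times> nat"

end

theory Submission
  imports Defs
begin

text \<open>If \<open>f\<close> is a continuous covering map on a metric space \<open>M\<close>, the images of the balls centred in
  the fibre of \<open>x\<close> form a network at \<open>x\<close>: lift a sequence converging to \<open>x\<close> and use the balls of
  radius \<open>1 / (k + 1)\<close> around the limit of the lift.

  Conversely, each convergent sequence \<open>s\<close> with limit \<open>s 0\<close> has a countable family of sets \<open>Q s k\<close>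
  shrinking to its limit, each containing the terms of \<open>s\<close> outside a set of the ideal. Make \<open>\<nat>\<close>
  a metric space by \<open>d m n = max (h m) (h n)\<close> for \<open>m \<noteq> n\<close>, where \<open>h 0 = 0\<close> and \<open>h n\<close> for
  \<open>n > 0\<close> is small only if \<open>n\<close> is large and \<open>s n\<close> lies in many of the sets \<open>Q s k\<close>.
  All points but \<open>0\<close> are isolated, \<open>s\<close> is continuous for this metric, and \<open>n\<close> converges to \<open>0\<close>
  along the ideal. The disjoint sum of these spaces over all \<open>s\<close> is the required metric space.\<close>

section \<open>Ideals, and convergence along an ideal in a metric space\<close>

lemma set_ideal_subset: "set_ideal \<I> \<Longrightarrow> A \<in> \<I> \<Longrightarrow> B \<subseteq> A \<Longrightarrow> B \<in> \<I>"
  by (meson set_ideal_def)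

lemma set_ideal_Un: "set_ideal \<I> \<Longrightarrow> A \<in> \<I> \<Longrightarrow> B \<in> \<I> \<Longrightarrow> A \<union> B \<in> \<I>"
  by (meson set_ideal_def)

lemma set_ideal_empty: "set_ideal \<I> \<Longrightarrow> {} \<in> \<I>"
  unfolding set_ideal_def by simp

lemma set_ideal_finite_UN:
  assumes "set_ideal \<I>" "finite K" "\<And>k. k \<in> K \<Longrightarrow> A k \<in> \<I>"
  shows "(\<Union>k\<in>K. A k) \<in> \<I>"
  using assms(2,3)
  by (induction K) (simp_all add: set_ideal_empty set_ideal_Un assms(1))

text \<open>Every neighbourhood contains a ball, and a larger neighbourhood has a smaller
  exceptional set; closure of the ideal under subsets does the rest.\<close>

lemma (in Metric_space) ideal_convergent_mtopology:
  assumes "set_ideal \<I>"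
  shows "ideal_convergent \<I> mtopology s x \<longleftrightarrow>
    (\<forall>n\<ge>1. s n \<in> M) \<and> x \<in> M \<and> (\<forall>\<epsilon>>0. {n \<in> {1..}. s n \<notin> mball x \<epsilon>} \<in> \<I>)"
    (is "?L \<longleftrightarrow> ?R")
proof
  assume L: ?L
  show ?R
  proof (intro conjI allI impI)
    fix \<epsilon> :: real
    assume "\<epsilon> > 0"
    moreover have "x \<in> M"
      using L by (simp add: ideal_convergent_def)
    ultimately have "x \<in> mtopology interior_of (mball x \<epsilon>)"
      by (simp add: interior_of_openin)
    moreover have "mball x \<epsilon> \<subseteq> topspace mtopology"
      by auto
    ultimately show "{n \<in> {1..}. s n \<notin> mball x \<epsilon>} \<in> \<I>"
      using L by (simp add: ideal_convergent_def del: in_mball)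
  qed (use L in \<open>simp_all add: ideal_convergent_def\<close>)
next
  assume R: ?R
  have "{n \<in> {1..}. s n \<notin> U} \<in> \<I>" if "x \<in> mtopology interior_of U" for U
  proof -
    obtain T where T: "openin mtopology T" "x \<in> T" "T \<subseteq> U"
      using \<open>x \<in> mtopology interior_of U\<close> unfolding interior_of_def by blast
    obtain \<epsilon> where \<epsilon>: "\<epsilon> > 0" "mball x \<epsilon> \<subseteq> T"
      using T(1,2) unfolding openin_mtopology by blast
    have "{n \<in> {1..}. s n \<notin> U} \<subseteq> {n \<in> {1..}. s n \<notin> mball x \<epsilon>}"
      using \<epsilon>(2) T(3) by blast
    moreover have "{n \<in> {1..}. s n \<notin> mball x \<epsilon>} \<in> \<I>"
      using R \<epsilon>(1) by blast
    ultimately show ?thesis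
      using set_ideal_subset[OF assms] by blast
  qed
  then show ?L
    using R by (simp add: ideal_convergent_def)
qed

section \<open>From a metric cover to a network\<close>

lemma ideal_csf_network_of_metric_image:
  fixes M :: "'m metric"
  assumes "set_ideal \<I>"
    and cont: "continuous_map (mtopology_of M) X f"
    and cov: "ideal_covering_map \<I> (mtopology_of M) X f"
  shows "\<exists>\<P>. ideal_csf_network \<I> X \<P>"
proof -
  interpret Metric_space "mspace M" "mdist M"
    by simp
  note cont' = cont[unfolded mtopology_of_def] and cov' = cov[unfolded mtopology_of_def]
  \<comment> \<open>The whole fibre has to supply centres, because the limit of a lift depends on
    the sequence being lifted.\<close>
  define \<P> where "\<P> x = {f ` mball m r | m r. m \<in> mspace M \<and> f m = x}" for x
  have "ideal_csf_network_at \<I> X x (\<P> x)" for x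
    unfolding ideal_csf_network_at_def
  proof (intro conjI allI impI)
    show "\<P> x \<subseteq> Pow (topspace X)"
      using continuous_map_funspace[OF cont'] by (fastforce simp: \<P>_def)
    fix t
    assume "ideal_convergent \<I> X t x"
    then obtain s m where s: "ideal_convergent \<I> mtopology s m" "f m = x" "\<And>n. n \<ge> 1 \<Longrightarrow> f (s n) = t n"
      using cov' unfolding ideal_covering_map_def by metis
    then have m: "m \<in> mspace M"
      by (simp add: ideal_convergent_def)
    \<comment> \<open>This countable family depends on the sequence only through \<open>m\<close>
      and is fixed before any \<open>U\<close> is given.\<close>
    define \<P>' where "\<P>' = range (\<lambda>k. f ` mball m (inverse (real (Suc k))))"
    have "\<exists>A\<in>\<I>. \<exists>P\<in>\<P>'. {x} \<union> t ` ({1..} - A) \<subseteq> P \<and> P \<subseteq> U" if U: "openin X U" "x \<in> U" for U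
    proof -
      have "openin mtopology {p \<in> mspace M. f p \<in> U}"
        using openin_continuous_map_preimage[OF cont' U(1)] by simp
      then obtain r where r: "r > 0" "mball m r \<subseteq> {p \<in> mspace M. f p \<in> U}"
        unfolding openin_mtopology using s(2) m U(2) by blast
      then obtain k where k: "inverse (real (Suc k)) < r"
        using reals_Archimedean by blast
      define B where "B = mball m (inverse (real (Suc k)))"
      have "B \<subseteq> mball m r"
        unfolding B_def using k by (intro mball_subset_concentric) simp
      moreover have "m \<in> B"
        using m by (simp add: B_def)
      moreover have "f ` B \<in> \<P>'"
        by (auto simp: \<P>'_def B_def)
      moreover have "{n \<in> {1..}. s n \<notin> B} \<in> \<I>"
        using s(1) unfolding ideal_convergent_mtopology[OF assms(1)] B_def
        by (metis inverse_positive_iff_positive of_nat_0_less_iff zero_less_Suc)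
      moreover have "t ` ({1..} - {n \<in> {1..}. s n \<notin> B}) \<subseteq> f ` B"
        using s(3) by force
      ultimately show ?thesis
        using r(2) s(2) by (intro bexI[of _ "{n \<in> {1..}. s n \<notin> B}"] bexI[of _ "f ` B"]) auto
    qed
    moreover have "\<P>' \<subseteq> \<P> x"
      using m s(2) by (auto simp: \<P>'_def \<P>_def)
    ultimately show "\<exists>\<P>'. countable \<P>' \<and> \<P>' \<subseteq> \<P> x \<and> (\<forall>U. openin X U \<longrightarrow> x \<in> U \<longrightarrow>
        (\<exists>A\<in>\<I>. \<exists>P\<in>\<P>'. {x} \<union> t ` ({1..} - A) \<subseteq> P \<and> P \<subseteq> U))"
      by (intro exI[of _ \<P>']) (auto simp: \<P>'_def)
  qed
  then show ?thesis
    unfolding ideal_csf_network_def by (intro exI[of _ "\<Union>x\<in>topspace X. \<P> x"]) blast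
qed

section \<open>From a network to a metric cover\<close>

text \<open>The metric built later counts how many sets in a row contain a term, so the countable
  subfamily is replaced by an enumeration.\<close>

lemma ideal_csf_network_at_sequence:
  assumes "set_ideal \<I>" "ideal_csf_network_at \<I> X x \<P>" "ideal_convergent \<I> X s x"
  obtains Q :: "nat \<Rightarrow> 'a set"
  where "\<And>k. {n \<in> {1..}. s n \<notin> Q k} \<in> \<I>"
    and "\<And>U. openin X U \<Longrightarrow> x \<in> U \<Longrightarrow> \<exists>k. Q k \<subseteq> U"
proof -
  obtain \<P>' where \<P>': "countable \<P>'" "\<And>U. openin X U \<Longrightarrow> x \<in> U \<Longrightarrow>
      \<exists>A\<in>\<I>. \<exists>P\<in>\<P>'. {x} \<union> s ` ({1..} - A) \<subseteq> P \<and> P \<subseteq> U"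
    using assms(2)[unfolded ideal_csf_network_at_def, THEN conjunct2, rule_format, OF assms(3)] by blast
  \<comment> \<open>Sets that miss too many terms are discarded. The witnesses \<open>P\<close>
    survive, since their exceptional set lies inside the given \<open>A\<close>.\<close>
  define \<Q> where "\<Q> = {P \<in> \<P>'. {n \<in> {1..}. s n \<notin> P} \<in> \<I>}"
  have *: "\<exists>P\<in>\<Q>. P \<subseteq> U" if U: "openin X U" "x \<in> U" for U
  proof -
    obtain A P where AP: "A \<in> \<I>" "P \<in> \<P>'" "s ` ({1..} - A) \<subseteq> P" "P \<subseteq> U"
      using \<P>'(2)[OF U] by (auto simp del: image_subset_iff)
    have "{n \<in> {1..}. s n \<notin> P} \<subseteq> A"
      using AP(3) by blast
    then have "{n \<in> {1..}. s n \<notin> P} \<in> \<I>"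
      using set_ideal_subset[OF assms(1) AP(1)] by blast
    then show ?thesis
      using AP(2,4) unfolding \<Q>_def by blast
  qed
  have "countable \<Q>"
    using \<P>'(1) by (simp add: \<Q>_def)
  \<comment> \<open>Taking the whole space for \<open>U\<close> gives a member;
    \<open>from_nat_into\<close> enumerates exactly the set only if it is nonempty.\<close>
  moreover have "\<Q> \<noteq> {}"
    using *[OF openin_topspace] assms(3) unfolding ideal_convergent_def by blast
  ultimately have "range (from_nat_into \<Q>) = \<Q>"
    by (rule range_from_nat_into[rotated])
  then have Q: "from_nat_into \<Q> k \<in> \<Q>" "P \<in> \<Q> \<Longrightarrow> \<exists>k. from_nat_into \<Q> k = P" for k P
    by (metis rangeI, metis imageE)
  show thesis
  proof (rule that)
    show "{n \<in> {1..}. s n \<notin> from_nat_into \<Q> k} \<in> \<I>" for k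
      using Q(1)[of k] unfolding \<Q>_def by blast
    show "\<exists>k. from_nat_into \<Q> k \<subseteq> U" if "openin X U" "x \<in> U" for U
      using *[OF that] Q(2) by metis
  qed
qed

text \<open>Here \<open>h\<close> is the height of a point above the centre of its summand. A path
  leaving a summand has length at least 1, which bounds all heights; inside a summand the triangle
  inequality is one for maxima. Distances vanish only on the diagonal because at most one point per
  summand has height 0. The value 0 off \<open>S\<close> keeps \<open>d\<close> nonnegative and
  symmetric everywhere.\<close>

lemma Metric_space_hedgehog_sum:
  fixes h :: "'i \<times> 'b \<Rightarrow> real"
  assumes h: "\<And>p. p \<in> S \<Longrightarrow> 0 \<le> h p" "\<And>p. p \<in> S \<Longrightarrow> h p \<le> 1"
    and inj: "\<And>p q. p \<in> S \<Longrightarrow> q \<in> S \<Longrightarrow> fst p = fst q \<Longrightarrow> h p = 0 \<Longrightarrow> h q = 0 \<Longrightarrow> p = q"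
  shows "Metric_space S (\<lambda>p q. if p \<in> S \<and> q \<in> S \<and> p \<noteq> q
    then if fst p = fst q then max (h p) (h q) else 1 else 0)"
proof
  fix p q r
  assume "p \<in> S" "q \<in> S" "r \<in> S"
  then show "(if p \<in> S \<and> r \<in> S \<and> p \<noteq> r then if fst p = fst r then max (h p) (h r) else 1 else 0)
    \<le> (if p \<in> S \<and> q \<in> S \<and> p \<noteq> q then if fst p = fst q then max (h p) (h q) else 1 else 0) +
      (if q \<in> S \<and> r \<in> S \<and> q \<noteq> r then if fst q = fst r then max (h q) (h r) else 1 else 0)"
    using h[of p] h[of q] h[of r] by (auto simp: max_def)
next
  fix p q
  assume "p \<in> S" "q \<in> S"
  then show "((if p \<in> S \<and> q \<in> S \<and> p \<noteq> q then if fst p = fst q then max (h p) (h q) else 1 else 0) = 0)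
      \<longleftrightarrow> p = q"
    using h[of p] h[of q] inj[of p q] by (auto simp: max_def split: if_splits)
next
  fix p q
  show "0 \<le> (if p \<in> S \<and> q \<in> S \<and> p \<noteq> q then if fst p = fst q then max (h p) (h q) else 1 else 0)"
    using h[of p] by (auto simp: le_max_iff_disj)
  show "(if p \<in> S \<and> q \<in> S \<and> p \<noteq> q then if fst p = fst q then max (h p) (h q) else 1 else 0) =
    (if q \<in> S \<and> p \<in> S \<and> q \<noteq> p then if fst q = fst p then max (h q) (h p) else 1 else 0)"
    by (simp add: max.commute[of "h p"] eq_commute[of p] eq_commute[of "fst p"] conj_ac)
qed

lemma metric_cover_of_ideal_csf_network:
  fixes X :: "'a topology"
  assumes adm: "admissible_ideal \<I>" and net: "ideal_csf_network \<I> X \<P>"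
  shows "\<exists>(M :: 'a seq_point metric) f. continuous_map (mtopology_of M) X f \<and>
    f ` mspace M = topspace X \<and> ideal_covering_map \<I> (mtopology_of M) X f"
proof -
  have ideal: "set_ideal \<I>" and single: "\<And>n. n \<ge> 1 \<Longrightarrow> {n} \<in> \<I>"
    using adm by (auto simp: admissible_ideal_def)
  \<comment> \<open>Since \<open>X\<close> need not be Hausdorff, a sequence may have several
    limits; each choice of limit gives its own summand.\<close>
  define C where "C = {s. ideal_convergent \<I> X s (s 0)}"
  have topspaceC: "s n \<in> topspace X" if "s \<in> C" for s n
    using that by (cases "n = 0") (auto simp: C_def ideal_convergent_def)
  have "\<exists>Q :: nat \<Rightarrow> 'a set. (\<forall>k. {n \<in> {1..}. s n \<notin> Q k} \<in> \<I>) \<and>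
      (\<forall>U. openin X U \<longrightarrow> s 0 \<in> U \<longrightarrow> (\<exists>k. Q k \<subseteq> U))" if s: "s \<in> C" for s
  proof -
    obtain \<P>x where "ideal_csf_network_at \<I> X (s 0) \<P>x"
      using net topspaceC[OF s, of 0] unfolding ideal_csf_network_def by metis
    then show ?thesis
      using ideal_csf_network_at_sequence[OF ideal, of X "s 0" \<P>x s] s unfolding C_def
      by (metis mem_Collect_eq)
  qed
  then obtain Q :: "(nat \<Rightarrow> 'a) \<Rightarrow> nat \<Rightarrow> 'a set" where
    Q: "\<And>s k. s \<in> C \<Longrightarrow> {n \<in> {1..}. s n \<notin> Q s k} \<in> \<I>"
      "\<And>s U. s \<in> C \<Longrightarrow> openin X U \<Longrightarrow> s 0 \<in> U \<Longrightarrow> \<exists>k. Q s k \<subseteq> U"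
    by metis
  \<comment> \<open>The number of initial sets \<open>Q s 0, Q s 1, ...\<close> containing
    \<open>s n\<close>, capped at \<open>n\<close>. The cap makes the minimum exist even if
    \<open>s n\<close> lies in all of them, and keeps heights positive.\<close>
  define L where "L s n = (LEAST k. k = n \<or> s n \<notin> Q s k)" for s n
  have L1: "L s n = n \<or> s n \<notin> Q s (L s n)" for s n
    unfolding L_def by (rule LeastI[of _ n]) simp
  have L2: "s n \<in> Q s k" if "k < L s n" for s n k
    using not_less_Least[OF that[unfolded L_def]] by blast
  define h where "h p = (if snd p = 0 then 0 else inverse (real (Suc (L (fst p) (snd p)))))" for p
  define S :: "'a seq_point set" where "S = C \<times> UNIV"
  have mem_S: "(s, n) \<in> S \<longleftrightarrow> s \<in> C" for s n
    by (simp add: S_def)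
  define d where "d p q = (if p \<in> S \<and> q \<in> S \<and> p \<noteq> q
    then if fst p = fst q then max (h p) (h q) else 1 else 0)" for p q :: "'a seq_point"
  have h_le: "0 \<le> h p" "h p \<le> 1" for p
    by (auto simp: h_def field_simps)
  have h_pos: "h p > 0" if "snd p \<noteq> 0" for p
    using that by (simp add: h_def)
  interpret Metric_space S d
    unfolding d_def
    by (rule Metric_space_hedgehog_sum[of S h]) (use h_le in \<open>auto simp: h_def split: if_splits\<close>)
  define M where "M = metric (S, d)"
  have M: "mtopology_of M = mtopology" "mspace M = S"
    by (simp_all add: M_def mtopology_of_def Metric_space_axioms)
  define f :: "'a seq_point \<Rightarrow> 'a" where "f p = fst p (snd p)" for p
  have fS: "f p \<in> topspace X" if "p \<in> S" for p
    using that topspaceC by (auto simp: S_def f_def)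
  have "continuous_map mtopology X f"
    unfolding continuous_map_def
  proof (intro conjI allI impI)
    fix U
    assume U: "openin X U"
    have "\<exists>r>0. mball p r \<subseteq> {p \<in> S. f p \<in> U}" if p: "p \<in> S" "f p \<in> U" for p
    proof (cases "snd p = 0")
      case True
      then obtain s where s: "p = (s, 0)" "s \<in> C" "s 0 \<in> U"
        using p by (cases p) (auto simp: S_def f_def)
      obtain k where k: "Q s k \<subseteq> U"
        using Q(2)[OF s(2) U s(3)] by blast
      have "f q \<in> U" if q: "q \<in> S" "d p q < inverse (real (Suc k))" for q
      proof (cases "q = p")
        case False
        \<comment> \<open>Other summands are at distance 1, so this radius confines the ball to the
          summand of \<open>s\<close>.\<close>
        have "inverse (real (Suc k)) \<le> 1"
          by (simp add: field_simps)
        then have *: "fst q = s" "h q < inverse (real (Suc k))"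
          using q False p(1) s(1) by (auto simp: d_def split: if_splits)
        with False s(1) have "snd q \<noteq> 0"
          by (cases q) auto
        with * have "k < L s (snd q)"
          by (auto simp: h_def field_simps)
        then show ?thesis
          using L2 k * by (auto simp: f_def)
      qed (use p in simp)
      then show ?thesis
        by (intro exI[of _ "inverse (real (Suc k))"]) auto
    next
      case False
      \<comment> \<open>Any other point is at distance at least \<open>h p\<close>, so
        \<open>p\<close> is isolated.\<close>
      have "q = p" if "q \<in> S" "d p q < h p" for q
        using that p(1) h_le(2)[of p] by (auto simp: d_def split: if_splits)
      then have "mball p (h p) \<subseteq> {p}"
        by auto
      then show ?thesis
        using h_pos[OF False] p by (intro exI[of _ "h p"]) blast
    qed
    then show "openin mtopology {p \<in> topspace mtopology. f p \<in> U}"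
      unfolding openin_mtopology by auto
  qed (use fS in auto)
  moreover have "f ` S = topspace X"
  proof
    show "topspace X \<subseteq> f ` S"
    proof
      fix x
      assume "x \<in> topspace X"
      \<comment> \<open>A constant sequence converges with empty exceptional sets, which gives
        surjectivity.\<close>
      then have "(\<lambda>_. x) \<in> C"
        using set_ideal_empty[OF ideal] subsetD[OF interior_of_subset, of x X]
        by (simp add: C_def ideal_convergent_def)
      then show "x \<in> f ` S"
        by (intro image_eqI[of _ _ "(\<lambda>_. x, 0)"]) (auto simp: S_def f_def)
    qed
  qed (use fS in auto)
  moreover have "ideal_covering_map \<I> mtopology X f"
    unfolding ideal_covering_map_def
  proof (intro conjI allI impI)
    fix t y
    assume t: "ideal_convergent \<I> X t y"
    define s where "s = t(0 := y)"
    have s: "s \<in> C"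
      using t by (auto simp: C_def s_def ideal_convergent_def cong: conj_cong)
    have "{n \<in> {1..}. (s, n) \<notin> mball (s, 0) \<epsilon>} \<in> \<I>" if "\<epsilon> > 0" for \<epsilon>
    proof -
      obtain k where k: "inverse (real (Suc k)) < \<epsilon>"
        using reals_Archimedean \<open>\<epsilon> > 0\<close> by blast
      \<comment> \<open>A point outside the ball has \<open>L s n\<close> at most \<open>k\<close>.
        Either the cap was reached, so \<open>n\<close> is at most \<open>k\<close>, or
        \<open>s n\<close> misses one of the first \<open>k + 1\<close> sets. Both unions are finite
        unions of members of the ideal.\<close>
      have "{n \<in> {1..}. (s, n) \<notin> mball (s, 0) \<epsilon>} \<subseteq>
          (\<Union>j\<in>{1..k}. {j}) \<union> (\<Union>j\<in>{..k}. {n \<in> {1..}. s n \<notin> Q s j})"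
      proof
        fix n
        assume "n \<in> {n \<in> {1..}. (s, n) \<notin> mball (s, 0) \<epsilon>}"
        then have n: "n \<ge> 1" "\<epsilon> \<le> inverse (real (Suc (L s n)))"
          using s by (auto simp: mem_S d_def h_def max_def split: if_splits)
        then have "inverse (real (Suc k)) < inverse (real (Suc (L s n)))"
          using k by linarith
        then have "L s n \<le> k"
          by (simp add: field_simps)
        then show "n \<in> (\<Union>j\<in>{1..k}. {j}) \<union> (\<Union>j\<in>{..k}. {n \<in> {1..}. s n \<notin> Q s j})"
          using L1[of s n] n(1) by auto
      qed
      moreover have "(\<Union>j\<in>{1..k}. {j}) \<union> (\<Union>j\<in>{..k}. {n \<in> {1..}. s n \<notin> Q s j}) \<in> \<I>"
        using Q(1)[OF s] single by (intro set_ideal_Un[OF ideal] set_ideal_finite_UN[OF ideal]) auto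
      ultimately show ?thesis
        using set_ideal_subset[OF ideal] by blast
    qed
    \<comment> \<open>The lift of \<open>t\<close> runs through the summand of \<open>s\<close>
      towards its centre.\<close>
    then have "ideal_convergent \<I> mtopology (Pair s) (s, 0)"
      using s by (auto simp: ideal_convergent_mtopology[OF ideal] mem_S simp del: in_mball)
    moreover have "f (s, 0) = y" "\<forall>n\<ge>1. f (s, n) = t n"
      by (auto simp: f_def s_def)
    ultimately show "\<exists>s x. ideal_convergent \<I> mtopology s x \<and> f x = y \<and> (\<forall>n\<ge>1. f (s n) = t n)"
      by blast
  qed (use fS in auto)
  ultimately show ?thesis
    using M by metis
qed

theorem theorem3p5:
  fixes \<I> :: "nat set set" and X :: "'a topology"
  assumes "admissible_ideal \<I>"
  shows "((\<exists>\<P>. ideal_csf_network \<I> X \<P>) \<longleftrightarrow>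
            (\<exists>(M :: 'a seq_point metric) f.
               continuous_map (mtopology_of M) X f \<and> f ` mspace M = topspace X \<and>
               ideal_covering_map \<I> (mtopology_of M) X f))
       \<and> ((\<exists>(M :: 'm metric) f.
               continuous_map (mtopology_of M) X f \<and> f ` mspace M = topspace X \<and>
               ideal_covering_map \<I> (mtopology_of M) X f)
            \<longrightarrow> (\<exists>\<P>. ideal_csf_network \<I> X \<P>))"
proof (intro conjI iffI impI; elim exE conjE)
  have ideal: "set_ideal \<I>"
    using assms by (simp add: admissible_ideal_def)
  show "\<exists>\<P>. ideal_csf_network \<I> X \<P>"
    if "continuous_map (mtopology_of M) X f" "ideal_covering_map \<I> (mtopology_of M) X f"
    for M :: "'a seq_point metric" and f
    using ideal_csf_network_of_metric_image[OF ideal that] .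
  show "\<exists>\<P>. ideal_csf_network \<I> X \<P>"
    if "continuous_map (mtopology_of M) X f" "ideal_covering_map \<I> (mtopology_of M) X f"
    for M :: "'m metric" and f
    using ideal_csf_network_of_metric_image[OF ideal that] .
qed (rule metric_cover_of_ideal_csf_network[OF assms])

end
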